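(* For every $\varphi\in\mathsf{Form}_\Box$: if $\mathsf{iK}+\mathsf{bem}\vdash\varphi$, then $\mathcal{MM}(\mathsf{CPC},\mathsf{IPC})\models\varphi$.
   Context: The modal language $\mathsf{Form}_\Box$ is generated by $\top$, $\bot$, propositional variables, $\wedge,\vee,\to$ and $\Box$; $\neg\varphi$ abbreviates $\varphi\to\bot$. $\mathsf{IPC}$ (over the modal language) is the Hilbert system whose axioms are all instances, with $A,B,C\in\mathsf{Form}_\Box$, of $A\to(B\to A)$; $(A\to B)\to((A\to(B\to C))\to(A\to C))$; $A\to(A\vee B)$; $B\to(A\vee B)$; $(A\vee B)\to((A\to C)\to((B\to C)\to C))$; $A\to(B\to(A\wedge B))$; $(A\wedge B)\to A$; $(A\wedge B)\to B$; $\bot\to A$; its only rule is modus ponens. $\mathsf{CPC}$ adds $\neg A\vee A$. $\Gamma\vdash_L\varphi$ denotes derivability from hypotheses $\Gamma$ using axioms of $L$ and modus ponens. $\mathsf{iK}+\mathsf{bem}$ is the least set of formulas containing all $\mathsf{IPC}$ axioms (instantiated in $\mathsf{Form}_\Box$), all instances of $\Box(\varphi\to\psi)\to(\Box\varphi\to\Box\psi)$ and of $\Box\varphi\vee\neg\Box\varphi$, and closed under modus ponens and necessitation (from $\varphi$ infer $\Box\varphi$). The class $\mathcal{MM}(\mathsf{CPC},\mathsf{IPC})$ consists of triples $\langle W,R,\{T_w\}_{w\in W}\rangle$ with $W\ne\emptyset$, $R\subseteq W\times W$, $T_w\subseteq\mathsf{Form}_\Box$, such that for each $w$ there is $L_w\in\{\mathsf{CPC},\mathsf{IPC}\}$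 with: (1) $\bot\notin T_w$; (2) $T_w\vdash_{L_w}\varphi\Rightarrow\varphi\in T_w$; (3) $\Box\varphi\in T_w$ iff $\varphi\in T_v$ for all $v$ with $wRv$; (4) $\neg\Box\varphi\in T_w$ iff $\varphi\notin T_v$ for some $v$ with $wRv$. $\mathcal{MM}(\mathsf{CPC},\mathsf{IPC})\models\varphi$ means $\varphi\in T_w$ for every such model and every $w\in W$. *)

theory Defs
  imports Main
begin

datatype 'p form =
    Top (\<open>\<^bold>\<top>\<close>)
  | Bot (\<open>\<^bold>\<bottom>\<close>)
  | Var 'p
  | Conj "'p form" "'p form" (infixr \<open>\<^bold>\<and>\<close> 75)
  | Disj "'p form" "'p form" (infixr \<open>\<^bold>\<or>\<close> 74)
  | Imp "'p form" "'p form" (infixr \<open>\<^bold>\<rightarrow>\<close> 73)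
  | Box "'p form" (\<open>\<^bold>\<box> _\<close> [80] 80)

abbreviation Neg :: "'p form \<Rightarrow> 'p form" (\<open>\<^bold>\<not> _\<close> [80] 80) where
  "\<^bold>\<not> A \<equiv> A \<^bold>\<rightarrow> \<^bold>\<bottom>"

text \<open>A propositional logic is identified with its set of axioms; modus ponens is the only rule.
  None of the axiom schemes mentions the constant \<^const>\<open>Top\<close>.\<close>

inductive_set IPC :: "'p form set" where
  "A \<^bold>\<rightarrow> (B \<^bold>\<rightarrow> A) \<in> IPC"
| "(A \<^bold>\<rightarrow> B) \<^bold>\<rightarrow> ((A \<^bold>\<rightarrow> (B \<^bold>\<rightarrow> C)) \<^bold>\<rightarrow> (A \<^bold>\<rightarrow> C)) \<in> IPC"
| "A \<^bold>\<rightarrow> (A \<^bold>\<or> B) \<in> IPC"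
| "B \<^bold>\<rightarrow> (A \<^bold>\<or> B) \<in> IPC"
| "(A \<^bold>\<or> B) \<^bold>\<rightarrow> ((A \<^bold>\<rightarrow> C) \<^bold>\<rightarrow> ((B \<^bold>\<rightarrow> C) \<^bold>\<rightarrow> C)) \<in> IPC"
| "A \<^bold>\<rightarrow> (B \<^bold>\<rightarrow> (A \<^bold>\<and> B)) \<in> IPC"
| "(A \<^bold>\<and> B) \<^bold>\<rightarrow> A \<in> IPC"
| "(A \<^bold>\<and> B) \<^bold>\<rightarrow> B \<in> IPC"
| "\<^bold>\<bottom> \<^bold>\<rightarrow> A \<in> IPC"

definition CPC :: "'p form set" where
  "CPC = IPC \<union> {\<^bold>\<not> A \<^bold>\<or> A | A. True}"

inductive derives :: "'p form set \<Rightarrow> 'p form set \<Rightarrow> 'p form \<Rightarrow> bool"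
    (\<open>_ \<turnstile>[_] _\<close> [60, 0, 60] 60)
  for \<Gamma> L :: "'p form set" where
  hyp: "A \<in> \<Gamma> \<Longrightarrow> \<Gamma> \<turnstile>[L] A"
| ax: "A \<in> L \<Longrightarrow> \<Gamma> \<turnstile>[L] A"
| mp: "\<Gamma> \<turnstile>[L] A \<^bold>\<rightarrow> B \<Longrightarrow> \<Gamma> \<turnstile>[L] A \<Longrightarrow> \<Gamma> \<turnstile>[L] B"

inductive_set iK_bem :: "'p form set" where
  ipc: "A \<in> IPC \<Longrightarrow> A \<in> iK_bem"
| K: "\<^bold>\<box> (A \<^bold>\<rightarrow> B) \<^bold>\<rightarrow> (\<^bold>\<box> A \<^bold>\<rightarrow> \<^bold>\<box> B) \<in> iK_bem"
| bem: "\<^bold>\<box> A \<^bold>\<or> \<^bold>\<not> (\<^bold>\<box> A) \<in> iK_bem"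
| mp: "A \<^bold>\<rightarrow> B \<in> iK_bem \<Longrightarrow> A \<in> iK_bem \<Longrightarrow> B \<in> iK_bem"
| nec: "A \<in> iK_bem \<Longrightarrow> \<^bold>\<box> A \<in> iK_bem"

text \<open>Only the values of \<open>T\<close> on the carrier \<open>W\<close> are relevant.\<close>

definition mixed_model ::
  "'p form set set \<Rightarrow> 'w set \<Rightarrow> ('w \<times> 'w) set \<Rightarrow> ('w \<Rightarrow> 'p form set) \<Rightarrow> bool" where
  "mixed_model \<L> W R T \<longleftrightarrow>
     W \<noteq> {} \<and> R \<subseteq> W \<times> W \<and>
     (\<forall>w\<in>W. \<exists>L\<in>\<L>.
        \<^bold>\<bottom> \<notin> T w \<and>
        (\<forall>A. T w \<turnstile>[L] A \<longrightarrow> A \<in> T w) \<and>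
        (\<forall>A. \<^bold>\<box> A \<in> T w \<longleftrightarrow> (\<forall>v. (w, v) \<in> R \<longrightarrow> A \<in> T v)) \<and>
        (\<forall>A. \<^bold>\<not> (\<^bold>\<box> A) \<in> T w \<longleftrightarrow> (\<exists>v. (w, v) \<in> R \<and> A \<notin> T v)))"

text \<open>HOL cannot quantify over types inside a formula, so the type of worlds is an explicit
  parameter; validity in the whole class is obtained by leaving \<open>'w\<close> a free type variable.\<close>

definition MM_valid :: "'w itself \<Rightarrow> 'p form set set \<Rightarrow> 'p form \<Rightarrow> bool" where
  "MM_valid _ \<L> A \<longleftrightarrow>
     (\<forall>(W :: 'w set) R T. mixed_model \<L> W R T \<longrightarrow> (\<forall>w\<in>W. A \<in> T w))"

end

theory Submission
  imports Defs
begin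

text \<open>Conditions (3) and (4) make every boxed formula decided at every world: \<open>\<box>A\<close> or \<open>\<not>\<box>A\<close>
  belongs to \<open>T w\<close>, according to the successors of \<open>w\<close>. This gives \<open>bem\<close> outright and reduces \<open>K\<close>
  to a case distinction: if \<open>\<box>B \<notin> T w\<close>, some successor omits \<open>B\<close>, hence omits \<open>A \<rightarrow> B\<close> or \<open>A\<close>, so
  one of the two antecedents of \<open>K\<close> is refuted in \<open>T w\<close>.\<close>

text \<open>This is what remains of a world's theory once its own logic is forgotten: closure under
  any logic extending \<open>IPC\<close> yields both properties, and soundness uses no other
  propositional closure.\<close>

definition IPC_theory :: "'p form set \<Rightarrow> bool" where
  "IPC_theory S \<longleftrightarrow> IPC \<subseteq> S \<and> (\<forall>A B. A \<^bold>\<rightarrow> B \<in> S \<longrightarrow> A \<in> S \<longrightarrow> B \<in> S)"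

lemma IPC_theory_axiom: "IPC_theory S \<Longrightarrow> A \<in> IPC \<Longrightarrow> A \<in> S"
  by (auto simp: IPC_theory_def)

lemma IPC_theory_mp: "IPC_theory S \<Longrightarrow> A \<^bold>\<rightarrow> B \<in> S \<Longrightarrow> A \<in> S \<Longrightarrow> B \<in> S"
  by (auto simp: IPC_theory_def)

lemma IPC_theory_if_derives_closed:
  fixes S :: "'a form set"
  assumes "IPC \<subseteq> L" and "\<And>A. S \<turnstile>[L] A \<Longrightarrow> A \<in> S"
  shows "IPC_theory S"
  unfolding IPC_theory_def
proof (intro conjI subsetI allI impI)
  fix A :: "'a form" assume "A \<in> IPC"
  with assms show "A \<in> S"
    by (blast intro: derives.ax)
next
  fix A B :: "'a form" assume "A \<^bold>\<rightarrow> B \<in> S" "A \<in> S"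
  then have "S \<turnstile>[L] B"
    by (meson derives.hyp derives.mp)
  then show "B \<in> S"
    by (rule assms(2))
qed

lemma IPC_theory_weaken:
  assumes "IPC_theory S" and "B \<in> S"
  shows "A \<^bold>\<rightarrow> B \<in> S"
  by (rule IPC_theory_mp[OF assms(1) IPC_theory_axiom[OF assms(1) IPC.intros(1)] assms(2)])

lemma IPC_theory_ex_falso:
  assumes S: "IPC_theory S" and "\<^bold>\<not> A \<in> S"
  shows "A \<^bold>\<rightarrow> B \<in> S"
proof -
  have "A \<^bold>\<rightarrow> (\<^bold>\<bottom> \<^bold>\<rightarrow> B) \<in> S"
    by (rule IPC_theory_weaken[OF S IPC_theory_axiom[OF S IPC.intros(9)]])
  \<comment> \<open>The second axiom scheme with \<open>\<bottom>\<close> as the middle formula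
    chains \<open>\<not> A\<close> with ex falso.\<close>
  moreover have "\<^bold>\<not> A \<^bold>\<rightarrow> ((A \<^bold>\<rightarrow> (\<^bold>\<bottom> \<^bold>\<rightarrow> B)) \<^bold>\<rightarrow> (A \<^bold>\<rightarrow> B)) \<in> S"
    by (rule IPC_theory_axiom[OF S IPC.intros(2)])
  ultimately show ?thesis
    using assms(2) IPC_theory_mp[OF S] by metis
qed

lemma IPC_theory_disjI1: "IPC_theory S \<Longrightarrow> A \<in> S \<Longrightarrow> A \<^bold>\<or> B \<in> S"
  by (rule IPC_theory_mp[OF _ IPC_theory_axiom[OF _ IPC.intros(3)]])

lemma IPC_theory_disjI2: "IPC_theory S \<Longrightarrow> B \<in> S \<Longrightarrow> A \<^bold>\<or> B \<in> S"
  by (rule IPC_theory_mp[OF _ IPC_theory_axiom[OF _ IPC.intros(4)]])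

text \<open>The logic may change from world to world, but every candidate contains
  \<open>IPC\<close>, so the conclusion is uniform in \<open>w\<close>.\<close>

lemma mixed_model_IPC_theory:
  assumes "mixed_model \<L> W R T" and "\<And>L. L \<in> \<L> \<Longrightarrow> IPC \<subseteq> L" and "w \<in> W"
  shows "IPC_theory (T w)"
proof -
  obtain L where "L \<in> \<L>" and "\<forall>A. T w \<turnstile>[L] A \<longrightarrow> A \<in> T w"
    using assms(1,3) unfolding mixed_model_def by meson
  with assms(2) show ?thesis
    by (intro IPC_theory_if_derives_closed[of L]) auto
qed

lemma mixed_model_Box:
  assumes "mixed_model \<L> W R T" and "w \<in> W"
  shows "\<^bold>\<box> A \<in> T w \<longleftrightarrow> (\<forall>v. (w, v) \<in> R \<longrightarrow> A \<in> T v)"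
  using assms unfolding mixed_model_def by meson

lemma mixed_model_Neg_Box:
  assumes "mixed_model \<L> W R T" and "w \<in> W"
  shows "\<^bold>\<not> (\<^bold>\<box> A) \<in> T w \<longleftrightarrow> (\<exists>v. (w, v) \<in> R \<and> A \<notin> T v)"
  using assms unfolding mixed_model_def by meson

lemma iK_bem_sound:
  assumes "A \<in> iK_bem" and M: "mixed_model \<L> W R T" and \<L>: "\<And>L. L \<in> \<L> \<Longrightarrow> IPC \<subseteq> L"
    and "w \<in> W"
  shows "A \<in> T w"
  using assms(1,4)
\<comment> \<open>The world is generalised because necessitation needs the induction hypothesis at
  the successors of \<open>w\<close>.\<close>
proof (induction arbitrary: w)
  case (ipc A)
  then show ?case
    by (intro IPC_theory_axiom[OF mixed_model_IPC_theory[OF M \<L>]])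
next
  case (K A B)
  note S = mixed_model_IPC_theory[OF M \<L> K]
  note Box = mixed_model_Box[OF M K] and Neg_Box = mixed_model_Neg_Box[OF M K]
  show ?case
  proof (cases "\<^bold>\<box> B \<in> T w")
    case True
    then show ?thesis
      by (intro IPC_theory_weaken S)
  next
    case False
    then obtain v where v: "(w, v) \<in> R" "B \<notin> T v"
      using Box by blast
    then have "v \<in> W"
      using M by (auto simp: mixed_model_def)
    then have "A \<^bold>\<rightarrow> B \<notin> T v \<or> A \<notin> T v"
      using v IPC_theory_mp[OF mixed_model_IPC_theory[OF M \<L>]] by metis
    then consider "\<^bold>\<not> (\<^bold>\<box> (A \<^bold>\<rightarrow> B)) \<in> T w" | "\<^bold>\<not> (\<^bold>\<box> A) \<in> T w"
      using v Neg_Box by blast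
    then show ?thesis
      \<comment> \<open>A refuted first antecedent gives the whole formula by ex falso; a refuted
        second one gives \<open>\<box> A \<rightarrow> \<box> B\<close> by ex falso, and then
        weakening adds the first.\<close>
      by cases (auto intro: IPC_theory_weaken IPC_theory_ex_falso S)
  qed
next
  case (bem A)
  note S = mixed_model_IPC_theory[OF M \<L> bem]
  show ?case
    using mixed_model_Box[OF M bem] mixed_model_Neg_Box[OF M bem]
      IPC_theory_disjI1[OF S] IPC_theory_disjI2[OF S] by metis
next
  case (mp A B)
  then show ?case
    using IPC_theory_mp[OF mixed_model_IPC_theory[OF M \<L>]] by metis
next
  case (nec A)
  \<comment> \<open>Successors stay in the carrier, so the induction hypothesis puts
    \<open>A\<close> in every \<open>T v\<close>, and condition (3) applies.\<close>
  moreover have "v \<in> W" if "(w, v) \<in> R" for v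
    using M that by (auto simp: mixed_model_def)
  ultimately show ?case
    using mixed_model_Box[OF M nec.prems] by blast
qed

theorem theorem3p2p1:
  fixes \<phi> :: "'p form"
  assumes "\<phi> \<in> iK_bem"
  shows "MM_valid TYPE('w) {CPC, IPC} \<phi>"
proof -
  have "IPC \<subseteq> L" if "L \<in> {CPC, IPC}" for L :: "'p form set"
    using that by (auto simp: CPC_def)
  then show ?thesis
    unfolding MM_valid_def by (intro allI impI ballI) (rule iK_bem_sound[OF assms])
qed

end
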